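(* There exist an absolute constant $C>0$ and an algorithm (Find-One-Unknown) with the following guarantee. Let $n\ge27$, $m\ge2$, $\varepsilon\in(0,1)$, let $P,Q$ be unknown distributions on $[n]$ with $\mathrm{d_{TV}}(P,Q)\ge\varepsilon$, and let $D_1,\dots,D_m$ be distributions on $[n]$ such that for an unknown set $\chi\subseteq[m]$ with $1\in\chi$, $D_i=P$ for $i\in\chi$ and $D_i=Q$ for $i\in[m]\setminus\chi$. Given sample access to the $D_i$ and $n,m,\varepsilon$, with probability at least $2/3$ the algorithm returns "All Identical" if $\chi=[m]$, and returns an index $j\in[m]\setminus\{1\}$ with $D_j\neq D_1$ if $\chi\neq[m]$. Its sample complexity is at most $$C\max\left(\left(\frac{nm}{\varepsilon^2}\right)^{2/3},\frac{m\sqrt n}{\varepsilon^2}\right)\log m.$$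
   Context: $\mathrm{d_{TV}}$ is total variation distance. Sample access means the algorithm may adaptively request independent samples from any $D_i$; sample complexity is the total number of samples drawn. *)

theory Defs
  imports "HOL-Probability.Probability"
begin

text \<open>Adaptive randomized sampling algorithms as decision trees.
  Sample i k: draw one sample x from D_i and continue with k x.
  Flip k: flip a fair internal coin b and continue with k b.
  Return r: halt with output r.\<close>
datatype 'r alg = Return 'r | Sample nat "nat \<Rightarrow> 'r alg" | Flip "bool \<Rightarrow> 'r alg"

primrec run :: "(nat \<Rightarrow> nat pmf) \<Rightarrow> 'r alg \<Rightarrow> 'r pmf" where
  "run D (Return r) = return_pmf r"
| "run D (Sample i k) = bind_pmf (D i) (\<lambda>x. run D (k x))"
| "run D (Flip k) = bind_pmf (bernoulli_pmf (1/2)) (\<lambda>b. run D (k b))"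

primrec samples_le :: "'r alg \<Rightarrow> real \<Rightarrow> bool" where
  "samples_le (Return r) B = True"
| "samples_le (Sample i k) B = (1 \<le> B \<and> (\<forall>x. samples_le (k x) (B - 1)))"
| "samples_le (Flip k) B = (\<forall>b. samples_le (k b) B)"

definition dTV :: "'a pmf \<Rightarrow> 'a pmf \<Rightarrow> real" where
  "dTV P Q = (SUP A. \<bar>measure_pmf.prob P A - measure_pmf.prob Q A\<bar>)"

end

theory Submission
  imports Defs
begin

text \<open>
  A first batch of \<open>k\<close> samples from \<open>D\<^sub>1\<close> gives the weights \<open>w x = 1 / (1 + count x)\<close>. With probability
  \<open>9/10\<close> they flatten \<open>P\<close>: \<open>\<Sum>x. w x P(x)\<^sup>2 \<le> 10 / k\<close>, while by Cauchy-Schwarz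
  \<open>\<theta> = \<Sum>x. w x (P(x) - Q(x))\<^sup>2 \<ge> \<epsilon>\<^sup>2 / (n + k)\<close>. This batch is shared by all tests, so that it may be
  much larger than the number of samples spent on a single \<open>D\<^sub>j\<close>.
  For each \<open>j\<close>, the U-statistic of the weighted collision kernel over \<open>O(n / (\<surd>k \<epsilon>\<^sup>2))\<close> pairs drawn from
  \<open>D\<^sub>1 \<times> D\<^sub>j\<close> is an unbiased estimate of \<open>\<theta>\<close> (or of \<open>0\<close> if \<open>D\<^sub>j = D\<^sub>1\<close>). Hoeffding's decomposition bounds its
  variance in terms of \<open>\<Sum>x. w x P(x)\<^sup>2\<close> and \<open>\<theta>\<close> only, so no bound on the norm of \<open>Q\<close> is needed, and
  Chebyshev's inequality shows that one test errs with probability at most \<open>1/16\<close>. A majority vote over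
  \<open>O(log m)\<close> repetitions makes a union bound over \<open>j\<close> possible. The choice
  \<open>k = min n \<lceil>(n m / \<epsilon>\<^sup>2)\<^bsup>2/3\<^esup>\<rceil>\<close> balances the two costs.
\<close>

section \<open>Expectations over finitely supported distributions\<close>

abbreviation expct :: "'a pmf \<Rightarrow> ('a \<Rightarrow> real) \<Rightarrow> real" where
  "expct \<equiv> measure_pmf.expectation"

lemma expct_add:
  assumes "finite (set_pmf p)"
  shows "expct p (\<lambda>x. f x + g x) = expct p f + expct p g"
  by (simp add: assms integrable_measure_pmf_finite)

lemma expct_diff:
  assumes "finite (set_pmf p)"
  shows "expct p (\<lambda>x. f x - g x) = expct p f - expct p g"
  by (simp add: assms integrable_measure_pmf_finite)

lemma expct_sum:
  assumes "finite (set_pmf p)"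
  shows "expct p (\<lambda>x. \<Sum>i\<in>I. f i x) = (\<Sum>i\<in>I. expct p (f i))"
  by (simp add: assms integrable_measure_pmf_finite)

lemma expct_mono:
  assumes "finite (set_pmf p)" "\<And>x. x \<in> set_pmf p \<Longrightarrow> f x \<le> g x"
  shows "expct p f \<le> expct p g"
  using assms by (intro integral_mono_AE) (auto simp: integrable_measure_pmf_finite AE_measure_pmf_iff)

lemma expct_nonneg: "(\<And>x. 0 \<le> f x) \<Longrightarrow> 0 \<le> expct p f"
  by (rule Bochner_Integration.integral_nonneg)

lemma expct_bind:
  assumes "finite (set_pmf p)" "\<And>x. x \<in> set_pmf p \<Longrightarrow> finite (set_pmf (f x))"
  shows "expct (bind_pmf p f) h = expct p (\<lambda>x. expct (f x) h)"
  using assms by (subst pmf_expectation_bind[OF assms(1)])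
    (auto simp: integral_measure_pmf[OF assms(1)])

lemma expct_swap:
  assumes "finite (set_pmf p)" "finite (set_pmf q)"
  shows "expct p (\<lambda>x. expct q (f x)) = expct q (\<lambda>y. expct p (\<lambda>x. f x y))"
proof -
  have "expct p (\<lambda>x. expct q (f x)) =
      (\<Sum>x\<in>set_pmf p. \<Sum>y\<in>set_pmf q. pmf p x * (pmf q y * f x y))"
    using assms by (simp add: integral_measure_pmf[OF assms(1)] integral_measure_pmf[OF assms(2)] sum_distrib_left)
  also have "\<dots> = expct q (\<lambda>y. expct p (\<lambda>x. f x y))"
    using assms by (subst sum.swap)
      (simp add: integral_measure_pmf[OF assms(1)] integral_measure_pmf[OF assms(2)] sum_distrib_left mult_ac)
  finally show ?thesis .
qed

lemma expct_pair_pmf: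
  assumes "finite (set_pmf p)" "finite (set_pmf q)"
  shows "expct (pair_pmf p q) f = expct p (\<lambda>x. expct q (\<lambda>y. f (x, y)))"
  using assms unfolding pair_pmf_def by (simp add: expct_bind)

lemma finite_set_replicate_pmf:
  assumes "finite (set_pmf p)"
  shows "finite (set_pmf (replicate_pmf n p))"
  using assms finite_lists_length_eq[OF assms, of n]
  by (simp add: set_replicate_pmf lists_eq_set Collect_conj_eq)

lemma expct_replicate_Suc:
  assumes "finite (set_pmf p)"
  shows "expct (replicate_pmf (Suc n) p) f = expct p (\<lambda>x. expct (replicate_pmf n p) (\<lambda>xs. f (x # xs)))"
  using assms by (simp add: expct_bind finite_set_replicate_pmf)

lemma square_expct_le:
  assumes "finite (set_pmf p)"
  shows "(expct p f)\<^sup>2 \<le> expct p (\<lambda>x. (f x)\<^sup>2)"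
    and "expct p (\<lambda>x. (f x - expct p f)\<^sup>2) \<le> expct p (\<lambda>x. (f x)\<^sup>2)"
proof -
  have *: "expct p (\<lambda>x. (f x - expct p f)\<^sup>2) = expct p (\<lambda>x. (f x)\<^sup>2) - (expct p f)\<^sup>2"
    by (rule measure_pmf.variance_eq) (simp_all add: assms integrable_measure_pmf_finite)
  have "0 \<le> expct p (\<lambda>x. (f x - expct p f)\<^sup>2)" by (simp add: expct_nonneg)
  with * show "(expct p f)\<^sup>2 \<le> expct p (\<lambda>x. (f x)\<^sup>2)" by simp
  from * show "expct p (\<lambda>x. (f x - expct p f)\<^sup>2) \<le> expct p (\<lambda>x. (f x)\<^sup>2)" by simp
qed

lemma markov_pmf:
  assumes "finite (set_pmf p)" "\<And>x. 0 \<le> f x" "0 < c"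
  shows "measure_pmf.prob p {x. c \<le> f x} \<le> expct p f / c"
proof -
  have "c * measure_pmf.prob p {x. c \<le> f x} = expct p (\<lambda>x. c * indicator {x. c \<le> f x} x)"
    by simp
  also have "\<dots> \<le> expct p f"
    using assms by (intro expct_mono) (auto simp: indicator_def)
  finally show ?thesis using assms(3) by (simp add: field_simps)
qed

section \<open>Variance of a U-statistic\<close>

text \<open>For symmetric \<open>H\<close> this is the sum over all ordered pairs of distinct
  positions, that is, the U-statistic with kernel \<open>H\<close> before normalisation. Leaving out
  the diagonal makes it unbiased up to that factor.\<close>

primrec pair_sum :: "('a \<Rightarrow> 'a \<Rightarrow> real) \<Rightarrow> 'a list \<Rightarrow> real" where
  "pair_sum H [] = 0"
| "pair_sum H (z # zs) = pair_sum H zs + 2 * sum_list (map (H z) zs)"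

text \<open>Independent centred terms are orthogonal: the cross term with a newly prepended draw
  vanishes.\<close>

lemma second_moment_sum_list:
  assumes fin: "finite (set_pmf p)" and mean: "expct p f = 0"
  shows "expct (replicate_pmf n p) (\<lambda>zs. (sum_list (map f zs))\<^sup>2) = n * expct p (\<lambda>z. (f z)\<^sup>2)"
proof (induction n)
  case 0
  show ?case by simp
next
  case (Suc n)
  let ?R = "replicate_pmf n p" and ?s = "\<lambda>zs. sum_list (map f zs)"
  have fR: "finite (set_pmf ?R)" using fin by (rule finite_set_replicate_pmf)
  have "expct ?R (\<lambda>zs. (f z + ?s zs)\<^sup>2) = (f z)\<^sup>2 + 2 * expct ?R ?s * f z + n * expct p (\<lambda>z. (f z)\<^sup>2)" for z
    using fR by (simp add: power2_sum expct_add Suc)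
  then show ?case
    by (simp only: expct_replicate_Suc[OF fin] list.map sum_list.Cons)
      (simp add: expct_add fin mean algebra_simps)
qed

text \<open>A kernel that averages to zero in either argument makes distinct pairs uncorrelated.
  Only the squares of the \<open>n * (n - 1) / 2\<close> unordered pairs survive, each with a factor
  4 from the doubled summand.\<close>

lemma second_moment_pair_sum_degenerate:
  assumes fin: "finite (set_pmf p)" and mean: "\<And>z. expct p (h z) = 0"
    and sym: "\<And>y z. h y z = h z y"
  shows "expct (replicate_pmf n p) (\<lambda>zs. (pair_sum h zs)\<^sup>2) =
    2 * n * (real n - 1) * expct p (\<lambda>y. expct p (\<lambda>z. (h y z)\<^sup>2))"
proof (induction n)
  case 0
  show ?case by simp
next
  case (Suc n)
  let ?R = "replicate_pmf n p" and ?s = "\<lambda>z zs. sum_list (map (h z) zs)"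
    and ?K = "expct p (\<lambda>y. expct p (\<lambda>z. (h y z)\<^sup>2))"
  have fR: "finite (set_pmf ?R)" using fin by (rule finite_set_replicate_pmf)
  \<comment> \<open>With \<open>zs\<close> fixed, averaging over the new draw kills the cross term;
    symmetry carries the mean-zero assumption over to the first argument.\<close>
  have cross: "expct p (\<lambda>z. ?s z zs) = 0" for zs
  proof (induction zs)
    case (Cons y zs)
    have "(\<lambda>z. h z y) = h y" using sym by auto
    then have "expct p (\<lambda>z. h z y) = 0" using mean by simp
    then show ?case using Cons by (simp add: expct_add fin)
  qed simp
  have "expct (replicate_pmf (Suc n) p) (\<lambda>zs. (pair_sum h zs)\<^sup>2) =
      expct p (\<lambda>z. expct ?R (\<lambda>zs. (pair_sum h zs)\<^sup>2 + 4 * (pair_sum h zs * ?s z zs) + 4 * (?s z zs)\<^sup>2))"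
    by (simp only: expct_replicate_Suc[OF fin])
      (simp add: power2_eq_square algebra_simps)
  also have "\<dots> = expct ?R (\<lambda>zs. (pair_sum h zs)\<^sup>2) +
      4 * expct p (\<lambda>z. expct ?R (\<lambda>zs. pair_sum h zs * ?s z zs)) + 4 * expct p (\<lambda>z. expct ?R (\<lambda>zs. (?s z zs)\<^sup>2))"
    by (simp add: expct_add fin fR)
  also have "expct p (\<lambda>z. expct ?R (\<lambda>zs. pair_sum h zs * ?s z zs)) = 0"
    by (subst expct_swap[OF fin fR]) (simp add: cross)
  also have "expct p (\<lambda>z. expct ?R (\<lambda>zs. (?s z zs)\<^sup>2)) = n * ?K"
    by (simp add: second_moment_sum_list[OF fin mean])
  finally show ?case by (simp add: Suc algebra_simps)
qed

text \<open>Substitute \<open>H y z = \<theta> + (g y - \<theta>) + (g z - \<theta>) +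
  remainder\<close> and count the pairs through each position. The identity is purely algebraic; it
  becomes Hoeffding's decomposition once \<open>g\<close> is the conditional mean of
  \<open>H\<close> and \<open>\<theta>\<close> its expectation.\<close>

lemma hoeffding_decomposition:
  "pair_sum H zs = real (length zs) * (real (length zs) - 1) * \<theta> +
     2 * (real (length zs) - 1) * sum_list (map (\<lambda>z. g z - \<theta>) zs) +
     pair_sum (\<lambda>y z. H y z - g y - g z + \<theta>) zs"
proof (induction zs)
  case (Cons y zs)
  have "sum_list (map (H y) zs) = sum_list (map (\<lambda>z. H y z - g y - g z + \<theta>) zs) +
      real (length zs) * g y + sum_list (map (\<lambda>z. g z - \<theta>) zs)"
    by (induction zs) (auto simp: algebra_simps)
  with Cons show ?case by (simp add: algebra_simps)
qed simp

text \<open>The linear and the degenerate part are separated by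
  \<open>(a + b)^2 \<le> 2 a^2 + 2 b^2\<close>, which yields 8 = 2 * 2^2 and 16 = 2 * 2 * 4. The
  sample size is written \<open>Suc M\<close> so that its predecessor needs no truncated
  subtraction.\<close>

lemma variance_pair_sum_le:
  fixes H :: "'a \<Rightarrow> 'a \<Rightarrow> real"
  assumes fin: "finite (set_pmf p)" and sym: "\<And>y z. H y z = H z y"
  defines "g \<equiv> \<lambda>y. expct p (H y)"
  shows "expct (replicate_pmf (Suc M) p) (\<lambda>zs. (pair_sum H zs - real (Suc M) * real M * expct p g)\<^sup>2) \<le>
    8 * real (Suc M) * (real M)\<^sup>2 * expct p (\<lambda>z. (g z)\<^sup>2) +
    16 * real (Suc M) * real M * expct p (\<lambda>y. expct p (\<lambda>z. (H y z)\<^sup>2))"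
proof -
  let ?R = "replicate_pmf (Suc M) p" and ?\<theta> = "expct p g"
  let ?h = "\<lambda>y z. H y z - g y - g z + ?\<theta>"
  let ?L = "\<lambda>zs. sum_list (map (\<lambda>z. g z - ?\<theta>) zs)"
  have fR: "finite (set_pmf ?R)" using fin by (rule finite_set_replicate_pmf)
  have "expct ?R (\<lambda>zs. (pair_sum H zs - real (Suc M) * real M * ?\<theta>)\<^sup>2) \<le>
      expct ?R (\<lambda>zs. 8 * (real M)\<^sup>2 * (?L zs)\<^sup>2 + 2 * (pair_sum ?h zs)\<^sup>2)"
  proof (rule expct_mono[OF fR])
    fix zs assume "zs \<in> set_pmf ?R"
    then have len: "length zs = Suc M" by (simp only: set_replicate_pmf) simp
    have eq: "pair_sum H zs - real (Suc M) * real M * ?\<theta> = 2 * real M * ?L zs + pair_sum ?h zs"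
      using hoeffding_decomposition[of H zs ?\<theta> g] len by simp
    have ineq: "(a + b)\<^sup>2 \<le> 2 * a\<^sup>2 + 2 * b\<^sup>2" for a b :: real
      using sum_squares_ge_zero[of "a - b" 0] by (simp add: power2_eq_square algebra_simps)
    show "(pair_sum H zs - real (Suc M) * real M * ?\<theta>)\<^sup>2 \<le> 8 * (real M)\<^sup>2 * (?L zs)\<^sup>2 + 2 * (pair_sum ?h zs)\<^sup>2"
      unfolding eq using ineq[of "2 * real M * ?L zs" "pair_sum ?h zs"] by (simp add: power_mult_distrib)
  qed
  also have "\<dots> = 8 * (real M)\<^sup>2 * expct ?R (\<lambda>zs. (?L zs)\<^sup>2) + 2 * expct ?R (\<lambda>zs. (pair_sum ?h zs)\<^sup>2)"
    using fR by (subst expct_add) auto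
  also have "expct ?R (\<lambda>zs. (?L zs)\<^sup>2) = real (Suc M) * expct p (\<lambda>z. (g z - ?\<theta>)\<^sup>2)"
    by (rule second_moment_sum_list[OF fin]) (simp add: expct_diff fin)
  also have "expct ?R (\<lambda>zs. (pair_sum ?h zs)\<^sup>2) =
      2 * real (Suc M) * (real (Suc M) - 1) * expct p (\<lambda>y. expct p (\<lambda>z. (?h y z)\<^sup>2))"
  proof (rule second_moment_pair_sum_degenerate[OF fin])
    show "expct p (?h z) = 0" for z
      by (simp add: expct_diff expct_add fin) (simp add: g_def)
  qed (simp add: sym)
  finally have main: "expct ?R (\<lambda>zs. (pair_sum H zs - real (Suc M) * real M * ?\<theta>)\<^sup>2) \<le>
      8 * real (Suc M) * (real M)\<^sup>2 * expct p (\<lambda>z. (g z - ?\<theta>)\<^sup>2) +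
      4 * real (Suc M) * real M * expct p (\<lambda>y. expct p (\<lambda>z. (?h y z)\<^sup>2))"
    by (simp only: of_nat_Suc) (simp add: algebra_simps)
  \<comment> \<open>The remainder is the difference of the centred variables
    \<open>H y z - g y\<close> and \<open>g z - \<theta>\<close>. Centring only lowers second
    moments, and the second moment of \<open>g\<close> is at most that of \<open>H\<close>, so the
    factor is 2 + 2.\<close>
  have "expct p (\<lambda>y. expct p (\<lambda>z. (?h y z)\<^sup>2)) \<le> 4 * expct p (\<lambda>y. expct p (\<lambda>z. (H y z)\<^sup>2))"
  proof -
    have "expct p (\<lambda>y. expct p (\<lambda>z. (?h y z)\<^sup>2)) \<le>
       expct p (\<lambda>y. expct p (\<lambda>z. 2 * (H y z - g y)\<^sup>2 + 2 * (g z - ?\<theta>)\<^sup>2))"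
    proof (intro expct_mono fin)
      show "(?h y z)\<^sup>2 \<le> 2 * (H y z - g y)\<^sup>2 + 2 * (g z - ?\<theta>)\<^sup>2" for y z
        using sum_squares_ge_zero[of "(H y z - g y) + (g z - ?\<theta>)" 0]
        by (simp add: power2_eq_square algebra_simps)
    qed
    also have "\<dots> = 2 * expct p (\<lambda>y. expct p (\<lambda>z. (H y z - g y)\<^sup>2)) + 2 * expct p (\<lambda>z. (g z - ?\<theta>)\<^sup>2)"
      by (simp add: expct_add fin)
    also have "expct p (\<lambda>y. expct p (\<lambda>z. (H y z - g y)\<^sup>2)) \<le> expct p (\<lambda>y. expct p (\<lambda>z. (H y z)\<^sup>2))"
      unfolding g_def by (intro expct_mono square_expct_le fin)
    also have "expct p (\<lambda>z. (g z - ?\<theta>)\<^sup>2) \<le> expct p (\<lambda>z. (g z)\<^sup>2)"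
      by (intro square_expct_le fin)
    also have "\<dots> \<le> expct p (\<lambda>y. expct p (\<lambda>z. (H y z)\<^sup>2))"
      unfolding g_def by (intro expct_mono square_expct_le fin)
    finally show ?thesis by simp
  qed
  then have "4 * real (Suc M) * real M * expct p (\<lambda>y. expct p (\<lambda>z. (?h y z)\<^sup>2)) \<le>
      4 * real (Suc M) * real M * (4 * expct p (\<lambda>y. expct p (\<lambda>z. (H y z)\<^sup>2)))"
    by (intro mult_left_mono) auto
  moreover have "8 * real (Suc M) * (real M)\<^sup>2 * expct p (\<lambda>z. (g z - ?\<theta>)\<^sup>2) \<le>
      8 * real (Suc M) * (real M)\<^sup>2 * expct p (\<lambda>z. (g z)\<^sup>2)"
    by (intro mult_left_mono square_expct_le fin) auto
  ultimately show ?thesis using main by linarith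
qed

section \<open>The weighted collision kernel\<close>

text \<open>The kernel is the inner product with weights \<open>w\<close> of the vectors
  \<open>e\<^sub>x - e\<^sub>y\<close> and \<open>e\<^sub>x\<^sub>' - e\<^sub>y\<^sub>'\<close>. With \<open>w x = 1 / (1 + c x)\<close> it is the average, over the
  random bins, of the unweighted kernel after splitting each \<open>x\<close> into \<open>1 + c x\<close> equal bins.\<close>
definition collision_kernel :: "('a \<Rightarrow> real) \<Rightarrow> 'a \<times> 'a \<Rightarrow> 'a \<times> 'a \<Rightarrow> real" where
  "collision_kernel w u v =
     w (fst u) * (of_bool (fst v = fst u) - of_bool (snd v = fst u)) +
     w (snd u) * (of_bool (snd v = snd u) - of_bool (fst v = snd u))"

lemma collision_kernel_sym: "collision_kernel w u v = collision_kernel w v u"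
  by (auto simp: collision_kernel_def)

lemma expct_of_bool_eq: "expct p (\<lambda>x. of_bool (x = a)) = pmf p a"
proof -
  have "(\<lambda>x. of_bool (x = a) :: real) = indicator {a}" by (auto simp: indicator_def)
  then show ?thesis by (simp add: measure_pmf_single)
qed

lemma expct_eq_sum:
  assumes "finite A" "set_pmf p \<subseteq> A"
  shows "expct p f = (\<Sum>a\<in>A. pmf p a * f a)"
  using assms by (subst integral_measure_pmf[of A]) auto

context
  fixes P Q :: "'a pmf" and A :: "'a set" and w :: "'a \<Rightarrow> real"
  assumes finA: "finite A" and PA: "set_pmf P \<subseteq> A" and QA: "set_pmf Q \<subseteq> A"
    and w0: "\<And>x. 0 \<le> w x" and w1: "\<And>x. w x \<le> 1"
begin

private lemma finP: "finite (set_pmf P)" and finQ: "finite (set_pmf Q)"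
  using finA PA QA finite_subset by auto

private lemma finPQ: "finite (set_pmf (pair_pmf P Q))"
  using finP finQ by simp

private lemma expct_fst_snd:
  "expct (pair_pmf P Q) (\<lambda>u. c * (f (fst u) + f (snd u))) = c * (\<Sum>a\<in>A. (pmf P a + pmf Q a) * f a)"
  by (simp add: expct_add finP finQ expct_eq_sum[OF finA PA] expct_eq_sum[OF finA QA]
      sum.distrib distrib_right)

text \<open>The random vector e_x' - e_y' averages to P - Q, so the conditional mean is the weighted
  inner product of e_x - e_y with P - Q. This is the \<open>g\<close> of Hoeffding's
  decomposition.\<close>

lemma expct_collision_kernel:
  "expct (pair_pmf P Q) (collision_kernel w u) =
     w (fst u) * (pmf P (fst u) - pmf Q (fst u)) - w (snd u) * (pmf P (snd u) - pmf Q (snd u))"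
  by (simp add: collision_kernel_def expct_pair_pmf expct_add expct_diff finP finQ expct_of_bool_eq
      algebra_simps)

lemma expct_expct_collision_kernel:
  "expct (pair_pmf P Q) (\<lambda>u. expct (pair_pmf P Q) (collision_kernel w u)) =
     (\<Sum>a\<in>A. w a * (pmf P a - pmf Q a)\<^sup>2)"
  unfolding expct_collision_kernel
  by (simp add: expct_pair_pmf expct_diff finP finQ expct_eq_sum[OF finA PA] expct_eq_sum[OF finA QA]
      flip: sum_subtractf) (simp add: power2_eq_square algebra_simps)

text \<open>The kernel is a signed sum of four weighted indicators, whence the factor 4. Indicators
  equal their squares, so what remains is a collision probability weighted by \<open>w^2\<close>,
  and \<open>w^2 \<le> w\<close> on [0, 1].\<close>

lemma second_moment_collision_kernel:
  "expct (pair_pmf P Q) (\<lambda>u. expct (pair_pmf P Q) (\<lambda>v. (collision_kernel w u v)\<^sup>2)) \<le>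
     4 * (\<Sum>a\<in>A. w a * (pmf P a + pmf Q a)\<^sup>2)"
proof -
  let ?b = "\<lambda>u v. (w (fst u))\<^sup>2 * (of_bool (fst v = fst u) + of_bool (snd v = fst u)) +
     (w (snd u))\<^sup>2 * (of_bool (snd v = snd u) + of_bool (fst v = snd u))"
  have four: "(a + b + c + d)\<^sup>2 \<le> 4 * (a\<^sup>2 + b\<^sup>2 + c\<^sup>2 + d\<^sup>2)" for a b c d :: real
  proof -
    have "0 \<le> (a - b)\<^sup>2 + (a - c)\<^sup>2 + (a - d)\<^sup>2 + (b - c)\<^sup>2 + (b - d)\<^sup>2 + (c - d)\<^sup>2" by simp
    then show ?thesis by (simp add: power2_eq_square algebra_simps)
  qed
  have ob: "(of_bool c)\<^sup>2 = (of_bool c :: real)" for c by simp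
  have "(collision_kernel w u v)\<^sup>2 \<le> 4 * ?b u v" for u v
    using four[of "w (fst u) * of_bool (fst v = fst u)" "- w (fst u) * of_bool (snd v = fst u)"
        "w (snd u) * of_bool (snd v = snd u)" "- w (snd u) * of_bool (fst v = snd u)"]
    unfolding collision_kernel_def power_mult_distrib ob power2_minus by argo
  then have "expct (pair_pmf P Q) (\<lambda>u. expct (pair_pmf P Q) (\<lambda>v. (collision_kernel w u v)\<^sup>2)) \<le>
      expct (pair_pmf P Q) (\<lambda>u. expct (pair_pmf P Q) (\<lambda>v. 4 * ?b u v))"
    by (intro expct_mono finPQ)
  also have "\<dots> = expct (pair_pmf P Q) (\<lambda>u. 4 * ((w (fst u))\<^sup>2 * (pmf P (fst u) + pmf Q (fst u)) +
       (w (snd u))\<^sup>2 * (pmf P (snd u) + pmf Q (snd u))))"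
    by (simp add: expct_pair_pmf expct_add finP finQ expct_of_bool_eq algebra_simps)
  also have "\<dots> = 4 * (\<Sum>a\<in>A. (w a)\<^sup>2 * (pmf P a + pmf Q a)\<^sup>2)"
    by (subst expct_fst_snd[where f = "\<lambda>a. (w a)\<^sup>2 * (pmf P a + pmf Q a)"])
      (simp add: power2_eq_square mult_ac)
  also have "\<dots> \<le> 4 * (\<Sum>a\<in>A. w a * (pmf P a + pmf Q a)\<^sup>2)"
    using w0 w1 by (intro mult_left_mono sum_mono mult_right_mono)
      (auto simp: power2_eq_square mult_left_le)
  finally show ?thesis .
qed

text \<open>The left side is controlled by the maximum of \<open>w (P + Q)\<close> times the
  weighted squared distance, and a maximum is at most the Euclidean norm. Keeping the squared
  distance as a factor makes the bound vanish when the distributions agree.\<close>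

lemma second_moment_expct_collision_kernel:
  "expct (pair_pmf P Q) (\<lambda>u. (expct (pair_pmf P Q) (collision_kernel w u))\<^sup>2) \<le>
     2 * sqrt (\<Sum>a\<in>A. w a * (pmf P a + pmf Q a)\<^sup>2) * (\<Sum>a\<in>A. w a * (pmf P a - pmf Q a)\<^sup>2)"
    (is "_ \<le> 2 * sqrt ?S2 * _")
proof -
  let ?\<mu> = "\<lambda>a. pmf P a - pmf Q a"
  have "(expct (pair_pmf P Q) (collision_kernel w u))\<^sup>2 \<le>
      2 * ((w (fst u))\<^sup>2 * (?\<mu> (fst u))\<^sup>2 + (w (snd u))\<^sup>2 * (?\<mu> (snd u))\<^sup>2)" for u
    using sum_squares_ge_zero[of "w (fst u) * ?\<mu> (fst u) + w (snd u) * ?\<mu> (snd u)" 0]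
    unfolding expct_collision_kernel by (simp add: power2_eq_square algebra_simps)
  then have "expct (pair_pmf P Q) (\<lambda>u. (expct (pair_pmf P Q) (collision_kernel w u))\<^sup>2) \<le>
      expct (pair_pmf P Q) (\<lambda>u. 2 * ((w (fst u))\<^sup>2 * (?\<mu> (fst u))\<^sup>2 + (w (snd u))\<^sup>2 * (?\<mu> (snd u))\<^sup>2))"
    by (intro expct_mono finPQ)
  also have "\<dots> = 2 * (\<Sum>a\<in>A. (w a * (pmf P a + pmf Q a)) * (w a * (?\<mu> a)\<^sup>2))"
    by (subst expct_fst_snd[where f = "\<lambda>a. (w a)\<^sup>2 * (?\<mu> a)\<^sup>2"])
      (simp add: power2_eq_square mult_ac)
  also have "\<dots> \<le> 2 * (\<Sum>a\<in>A. sqrt ?S2 * (w a * (?\<mu> a)\<^sup>2))"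
  proof (intro mult_left_mono sum_mono mult_right_mono)
    fix a assume a: "a \<in> A"
    have "(w a * (pmf P a + pmf Q a))\<^sup>2 \<le> w a * (pmf P a + pmf Q a)\<^sup>2"
      unfolding power_mult_distrib using w0[of a] w1[of a]
      by (intro mult_right_mono) (auto simp: power2_eq_square mult_left_le)
    also have "\<dots> \<le> ?S2"
      using a finA w0 by (intro member_le_sum) auto
    finally show "w a * (pmf P a + pmf Q a) \<le> sqrt ?S2" by (rule real_le_rsqrt)
  qed (use w0 in auto)
  finally show ?thesis by (simp add: mult.assoc flip: sum_distrib_left)
qed

text \<open>The event is that of a wrong vote: the threshold is reached exactly when \<theta> is
  zero. Chebyshev's inequality handles both cases at once, with
  \<open>X = max \<theta> (\<delta>^2)\<close> as the common scale of the deviation.\<close>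

lemma collision_test:
  fixes b \<delta> :: real and M :: nat
  defines "\<theta> \<equiv> \<Sum>a\<in>A. w a * (pmf P a - pmf Q a)\<^sup>2"
  assumes b: "(\<Sum>a\<in>A. w a * (pmf P a)\<^sup>2) \<le> b\<^sup>2" and \<delta>: "0 < \<delta>" "\<delta> \<le> b"
    and M: "10240 * b / \<delta>\<^sup>2 \<le> real M" and gap: "\<theta> = 0 \<or> \<delta>\<^sup>2 \<le> \<theta>"
  shows "measure_pmf.prob (replicate_pmf (Suc M) (pair_pmf P Q))
    {zs. (real (Suc M) * real M * \<delta>\<^sup>2 / 2 \<le> pair_sum (collision_kernel w) zs) = (\<theta> = 0)} \<le> 1 / 16"
proof -
  define S2 where "S2 = (\<Sum>a\<in>A. w a * (pmf P a + pmf Q a)\<^sup>2)"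
  define S where "S = sqrt S2"
  define X where "X = max \<theta> (\<delta>\<^sup>2)"
  let ?N = "real (Suc M)" and ?M = "real M" and ?R = "replicate_pmf (Suc M) (pair_pmf P Q)"
  let ?U = "pair_sum (collision_kernel w)"
  have S2: "0 \<le> S2" and \<theta>: "0 \<le> \<theta>" unfolding S2_def \<theta>_def using w0 by (auto intro!: sum_nonneg)
  have S: "0 \<le> S" "S\<^sup>2 = S2" unfolding S_def using S2 by auto
  have X: "0 < X" "\<theta> \<le> X" "\<delta>\<^sup>2 \<le> X" using \<delta> by (auto simp: X_def less_max_iff_disj)
  have Mpos: "0 < ?M" using M \<delta> by (smt (verit) divide_pos_pos mult_pos_pos zero_less_power)
  \<comment> \<open>The collision mass of P + Q is traded for that of P plus \<theta>, so Q itself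
    needs no norm bound. The slack in each summand is the square of \<open>3 P - Q\<close>.\<close>
  have "S2 \<le> 8 * (\<Sum>a\<in>A. w a * (pmf P a)\<^sup>2) + 2 * \<theta>"
    unfolding S2_def \<theta>_def sum_distrib_left sum.distrib[symmetric]
  proof (intro sum_mono)
    fix a
    have "(pmf P a + pmf Q a)\<^sup>2 \<le> 8 * (pmf P a)\<^sup>2 + 2 * (pmf P a - pmf Q a)\<^sup>2"
      using sum_squares_ge_zero[of "3 * pmf P a - pmf Q a" 0] by (simp add: power2_eq_square algebra_simps)
    from mult_left_mono[OF this w0[of a]]
    show "w a * (pmf P a + pmf Q a)\<^sup>2 \<le> 8 * (w a * (pmf P a)\<^sup>2) + 2 * (w a * (pmf P a - pmf Q a)\<^sup>2)"
      by (simp add: algebra_simps)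
  qed
  also have "\<dots> \<le> 8 * b\<^sup>2 + 2 * X" using b X by simp
  also have "\<dots> \<le> (3 * b + 2 * sqrt X)\<^sup>2"
    using X \<delta> by (simp add: power2_sum power_mult_distrib)
  finally have "S \<le> 3 * b + 2 * sqrt X"
    unfolding S_def using X \<delta> by (intro real_le_lsqrt) auto
  \<comment> \<open>Both \<open>b\<close> and \<open>sqrt X\<close> are at most
    \<open>b X / \<delta>^2\<close>, because \<delta> is at most \<open>b\<close> and at most
    \<open>sqrt X\<close>; then 5 = 3 + 2. The assumption on \<open>M\<close> applies since 10240 =
    5 * 2048.\<close>
  also have "\<dots> \<le> 5 * b * X / \<delta>\<^sup>2"
  proof -
    have "b * 1 \<le> b * (X / \<delta>\<^sup>2)" using \<delta> X by (intro mult_left_mono) auto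
    moreover have "sqrt X \<le> b * (X / \<delta>\<^sup>2)"
    proof -
      have "\<delta> \<le> sqrt X" using X \<delta> by (simp add: real_le_rsqrt)
      then have "\<delta>\<^sup>2 * sqrt X \<le> b * (sqrt X * sqrt X)"
        using \<delta> X unfolding power2_eq_square mult.assoc by (intro mult_mono) auto
      then show ?thesis using X \<delta> by (simp add: field_simps)
    qed
    moreover have "5 * b * X / \<delta>\<^sup>2 = 5 * (b * (X / \<delta>\<^sup>2))" by simp
    ultimately show ?thesis by linarith
  qed
  also have "\<dots> = (10240 * b / \<delta>\<^sup>2) * X / 2048" by simp
  also have "\<dots> \<le> ?M * X / 2048"
    using M X by (intro divide_right_mono mult_right_mono) auto
  finally have S_le: "S \<le> ?M * X / 2048" .
  have "expct ?R (\<lambda>zs. (?U zs - ?N * ?M * \<theta>)\<^sup>2) \<le>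
      8 * ?N * ?M\<^sup>2 * (2 * S * \<theta>) + 16 * ?N * ?M * (4 * S\<^sup>2)"
  proof -
    have "8 * ?N * ?M\<^sup>2 * expct (pair_pmf P Q) (\<lambda>u. (expct (pair_pmf P Q) (collision_kernel w u))\<^sup>2)
        \<le> 8 * ?N * ?M\<^sup>2 * (2 * S * \<theta>)"
      using second_moment_expct_collision_kernel unfolding S_def S2_def \<theta>_def
      by (intro mult_left_mono) auto
    moreover have "16 * ?N * ?M * expct (pair_pmf P Q) (\<lambda>u. expct (pair_pmf P Q) (\<lambda>v. (collision_kernel w u v)\<^sup>2))
        \<le> 16 * ?N * ?M * (4 * S\<^sup>2)"
      using second_moment_collision_kernel S by (intro mult_left_mono) (auto simp: S2_def)
    ultimately show ?thesis
      using variance_pair_sum_le[OF finPQ, of "collision_kernel w" M, OF collision_kernel_sym]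
      unfolding expct_expct_collision_kernel \<theta>_def[symmetric] by linarith
  qed
  \<comment> \<open>The divisor 2048 turns the two terms into fractions 16/2048 = 1/128 and
    64/2048^2 = 1/65536, together below the 1/64 that Chebyshev's inequality requires.\<close>
  also have "\<dots> \<le> 8 * ?N * ?M\<^sup>2 * (2 * (?M * X / 2048) * X) + 16 * ?N * ?M * (4 * (?M * X / 2048)\<^sup>2)"
    using S_le S X \<theta> Mpos by (intro add_mono mult_mono mult_left_mono power_mono) auto
  also have "\<dots> = ?N * ?M * (?M\<^sup>2 * X\<^sup>2) * (1 / 128 + 1 / 65536)"
    by (simp add: power2_eq_square algebra_simps)
  also have "\<dots> \<le> ?N * ?M * (?N * ?M * X\<^sup>2) * (1 / 64)"
  proof -
    have "?M\<^sup>2 * X\<^sup>2 \<le> ?N * ?M * X\<^sup>2"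
      by (intro mult_right_mono) (auto simp: power2_eq_square distrib_right)
    then show ?thesis by (rule mult_mono[OF mult_left_mono]) auto
  qed
  finally have var: "expct ?R (\<lambda>zs. (?U zs - ?N * ?M * \<theta>)\<^sup>2) \<le> (?N * ?M * X / 2)\<^sup>2 / 16"
    by (simp add: power2_eq_square algebra_simps)
  have c: "0 < (?N * ?M * X / 2)\<^sup>2" using Mpos X by simp
  have "measure_pmf.prob ?R {zs. (?N * ?M * \<delta>\<^sup>2 / 2 \<le> ?U zs) = (\<theta> = 0)} \<le>
      measure_pmf.prob ?R {zs. (?N * ?M * X / 2)\<^sup>2 \<le> (?U zs - ?N * ?M * \<theta>)\<^sup>2}"
  proof (rule measure_pmf.finite_measure_mono)
    show "{zs. (?N * ?M * \<delta>\<^sup>2 / 2 \<le> ?U zs) = (\<theta> = 0)} \<subseteq>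
      {zs. (?N * ?M * X / 2)\<^sup>2 \<le> (?U zs - ?N * ?M * \<theta>)\<^sup>2}"
    proof (rule subsetI, unfold mem_Collect_eq)
      fix zs assume eq: "(?N * ?M * \<delta>\<^sup>2 / 2 \<le> ?U zs) = (\<theta> = 0)"
      \<comment> \<open>A wrong vote means rising from mean 0 to the threshold if \<theta> is zero,
        and otherwise falling from a mean of at least twice the threshold to below it.\<close>
      have "?N * ?M * X / 2 \<le> \<bar>?U zs - ?N * ?M * \<theta>\<bar>"
      proof (cases "\<theta> = 0")
        case True
        then show ?thesis using eq by (simp add: X_def)
      next
        case False
        then have \<theta>': "\<delta>\<^sup>2 \<le> \<theta>" "X = \<theta>" using gap by (auto simp: X_def)
        have "?N * ?M * \<delta>\<^sup>2 \<le> ?N * ?M * \<theta>" using \<theta>' by (intro mult_left_mono) auto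
        moreover have "?U zs < ?N * ?M * \<delta>\<^sup>2 / 2" using eq False by linarith
        ultimately show ?thesis unfolding \<theta>'(2) by linarith
      qed
      then have "\<bar>?N * ?M * X / 2\<bar> \<le> \<bar>?U zs - ?N * ?M * \<theta>\<bar>" using X by simp
      then show "(?N * ?M * X / 2)\<^sup>2 \<le> (?U zs - ?N * ?M * \<theta>)\<^sup>2" by (simp only: abs_le_square_iff)
    qed
  qed simp
  also have "\<dots> \<le> expct ?R (\<lambda>zs. (?U zs - ?N * ?M * \<theta>)\<^sup>2) / (?N * ?M * X / 2)\<^sup>2"
    using c by (intro markov_pmf finite_set_replicate_pmf finPQ) auto
  also have "\<dots> \<le> 1 / 16" using var c by (simp only: divide_le_eq) simp
  finally show ?thesis .
qed

end

section \<open>Flattening\<close>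

lemma expct_if_eq:
  assumes "finite (set_pmf p)"
  shows "expct p (\<lambda>x. if x = a then c else d) = pmf p a * c + (1 - pmf p a) * d"
proof -
  have "(\<lambda>x. if x = a then c else d) = (\<lambda>x. (c - d) * of_bool (x = a) + d)" by auto
  then show ?thesis
    by (simp only: expct_add[OF assms]) (simp add: expct_of_bool_eq, simp add: algebra_simps)
qed

lemma expct_count_list_Suc:
  assumes "finite (set_pmf p)"
  shows "expct (replicate_pmf (Suc k) p) (\<lambda>xs. \<phi> (count_list xs a)) =
    pmf p a * expct (replicate_pmf k p) (\<lambda>xs. \<phi> (Suc (count_list xs a))) +
    (1 - pmf p a) * expct (replicate_pmf k p) (\<lambda>xs. \<phi> (count_list xs a))"
proof -
  have "expct (replicate_pmf k p) (\<lambda>xs. \<phi> (count_list (x # xs) a)) =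
      (if x = a then expct (replicate_pmf k p) (\<lambda>xs. \<phi> (Suc (count_list xs a)))
       else expct (replicate_pmf k p) (\<lambda>xs. \<phi> (count_list xs a)))" for x
    by simp
  then show ?thesis by (simp only: expct_replicate_Suc[OF assms] expct_if_eq[OF assms])
qed

text \<open>This is the size-bias identity of the binomial distribution: singling out one counted
  draw leaves \<open>k\<close> independent ones. The induction conditions on the first draw and uses
  the hypothesis also for the shifted function, so \<phi> must be arbitrary.\<close>

lemma size_bias_count_list:
  assumes "finite (set_pmf p)"
  shows "expct (replicate_pmf (Suc k) p) (\<lambda>xs. real (count_list xs a) * \<phi> (count_list xs a)) =
    real (Suc k) * pmf p a * expct (replicate_pmf k p) (\<lambda>xs. \<phi> (Suc (count_list xs a)))"
proof (induction k arbitrary: \<phi>)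
  case 0
  show ?case
    using expct_count_list_Suc[OF assms, where k = 0 and a = a and \<phi> = "\<lambda>j. real j * \<phi> j"] by simp
next
  case (Suc k)
  let ?E = "\<lambda>k f. expct (replicate_pmf k p) (\<lambda>xs. f (count_list xs a) :: real)"
  have fR: "finite (set_pmf (replicate_pmf (Suc k) p))"
    using assms by (rule finite_set_replicate_pmf)
  have "?E (Suc (Suc k)) (\<lambda>j. real j * \<phi> j) =
      pmf p a * ?E (Suc k) (\<lambda>j. real (Suc j) * \<phi> (Suc j)) + (1 - pmf p a) * ?E (Suc k) (\<lambda>j. real j * \<phi> j)"
    by (rule expct_count_list_Suc[OF assms, where \<phi> = "\<lambda>j. real j * \<phi> j"])
  also have "?E (Suc k) (\<lambda>j. real (Suc j) * \<phi> (Suc j)) =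
      ?E (Suc k) (\<lambda>j. real j * \<phi> (Suc j)) + ?E (Suc k) (\<lambda>j. \<phi> (Suc j))"
    by (simp only: expct_add[OF fR, symmetric]) (simp add: algebra_simps)
  also have "?E (Suc k) (\<lambda>j. real j * \<phi> (Suc j)) = real (Suc k) * pmf p a * ?E k (\<lambda>j. \<phi> (Suc (Suc j)))"
    by (rule Suc.IH)
  also have "?E (Suc k) (\<lambda>j. real j * \<phi> j) = real (Suc k) * pmf p a * ?E k (\<lambda>j. \<phi> (Suc j))"
    by (rule Suc.IH)
  also have "pmf p a * (real (Suc k) * pmf p a * ?E k (\<lambda>j. \<phi> (Suc (Suc j))) + ?E (Suc k) (\<lambda>j. \<phi> (Suc j))) +
      (1 - pmf p a) * (real (Suc k) * pmf p a * ?E k (\<lambda>j. \<phi> (Suc j))) =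
      pmf p a * ?E (Suc k) (\<lambda>j. \<phi> (Suc j)) + real (Suc k) * pmf p a *
        (pmf p a * ?E k (\<lambda>j. \<phi> (Suc (Suc j))) + (1 - pmf p a) * ?E k (\<lambda>j. \<phi> (Suc j)))"
    by (simp only: algebra_simps)
  also have "pmf p a * ?E k (\<lambda>j. \<phi> (Suc (Suc j))) + (1 - pmf p a) * ?E k (\<lambda>j. \<phi> (Suc j)) =
      ?E (Suc k) (\<lambda>j. \<phi> (Suc j))"
    by (rule expct_count_list_Suc[OF assms, symmetric])
  finally show ?case
    by (simp only: of_nat_Suc) (simp only: algebra_simps)
qed

text \<open>Size-biasing with \<open>\<phi> j = 1 / j\<close> turns the left side into the mean of
  \<open>j * (1 / j)\<close>, which is at most 1, including at \<open>j = 0\<close> where division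
  gives 0.\<close>

lemma expct_inverse_count_list_le:
  assumes "finite (set_pmf p)"
  shows "pmf p a * expct (replicate_pmf k p) (\<lambda>xs. 1 / (1 + real (count_list xs a))) \<le> 1 / (1 + real k)"
proof -
  have "real (Suc k) * pmf p a * expct (replicate_pmf k p) (\<lambda>xs. 1 / real (Suc (count_list xs a))) =
      expct (replicate_pmf (Suc k) p) (\<lambda>xs. real (count_list xs a) * (1 / real (count_list xs a)))"
    by (rule size_bias_count_list[OF assms, where \<phi> = "\<lambda>j. 1 / real j", symmetric])
  also have "\<dots> \<le> expct (replicate_pmf (Suc k) p) (\<lambda>xs. 1)"
    by (intro expct_mono finite_set_replicate_pmf assms) simp
  finally show ?thesis by (simp add: field_simps)
qed

text \<open>One factor \<open>pmf p a\<close> is absorbed by the expected inverse count and the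
  other sums to 1, so the mean is at most \<open>1 / (1 + k)\<close>; Markov's inequality
  concludes.\<close>

lemma flattened_norm:
  assumes "finite A" "set_pmf p \<subseteq> A"
  shows "measure_pmf.prob (replicate_pmf k p)
    {xs. 10 / (1 + real k) \<le> (\<Sum>a\<in>A. 1 / (1 + real (count_list xs a)) * (pmf p a)\<^sup>2)} \<le> 1 / 10"
proof -
  let ?f = "\<lambda>xs. \<Sum>a\<in>A. 1 / (1 + real (count_list xs a)) * (pmf p a)\<^sup>2"
  have fin: "finite (set_pmf p)" using assms finite_subset by auto
  have "expct (replicate_pmf k p) ?f =
      (\<Sum>a\<in>A. pmf p a * (pmf p a * expct (replicate_pmf k p) (\<lambda>xs. 1 / (1 + real (count_list xs a)))))"
    by (subst expct_sum[OF finite_set_replicate_pmf[OF fin]]) (simp only: integral_mult_right_zero power2_eq_square mult_ac)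
  also have "\<dots> \<le> (\<Sum>a\<in>A. pmf p a * (1 / (1 + real k)))"
    by (intro sum_mono mult_left_mono expct_inverse_count_list_le fin) simp
  also have "\<dots> = 1 / (1 + real k)"
    using assms by (simp only: sum_distrib_right[symmetric] sum_pmf_eq_1 mult_1)
  finally have E: "expct (replicate_pmf k p) ?f \<le> 1 / (1 + real k)" .
  have "measure_pmf.prob (replicate_pmf k p) {xs. 10 / (1 + real k) \<le> ?f xs} \<le>
      expct (replicate_pmf k p) ?f / (10 / (1 + real k))"
    by (rule markov_pmf[OF finite_set_replicate_pmf[OF fin]]) (simp_all add: sum_nonneg)
  also have "\<dots> \<le> (1 / (1 + real k)) / (10 / (1 + real k))"
    using E by (intro divide_right_mono) auto
  also have "\<dots> = 1 / 10" by simp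
  finally show ?thesis .
qed

section \<open>Majority vote\<close>

text \<open>Exponential Markov inequality, with \<open>v\<close> the wrong vote:
  \<open>16 ^ count\<close> has mean \<open>(1 + 15 pmf p v) ^ T \<le> 2 ^ T\<close>, while a wrong
  majority or a tie forces it up to \<open>4 ^ T\<close>.\<close>

lemma majority_vote:
  assumes fin: "finite (set_pmf p)" and v: "pmf p v \<le> 1 / 16"
  shows "measure_pmf.prob (replicate_pmf T p) {xs. T \<le> 2 * count_list xs v} \<le> (1 / 2) ^ T"
proof -
  have "expct (replicate_pmf T p) (\<lambda>xs. 16 ^ count_list xs v) \<le> 2 ^ T"
  proof (induction T)
    case (Suc T)
    let ?E = "expct (replicate_pmf T p) (\<lambda>xs. 16 ^ count_list xs v)"
    have "expct (replicate_pmf (Suc T) p) (\<lambda>xs. 16 ^ count_list xs v) = (1 + 15 * pmf p v) * ?E"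
      by (subst expct_count_list_Suc[OF fin]) (simp add: algebra_simps)
    also have "\<dots> \<le> 2 * 2 ^ T"
      using Suc v by (intro mult_mono expct_nonneg) auto
    finally show ?case by simp
  qed simp
  then have E: "expct (replicate_pmf T p) (\<lambda>xs. 16 ^ count_list xs v) / 4 ^ T \<le> 2 ^ T / 4 ^ T"
    by (intro divide_right_mono) auto
  have "{xs. T \<le> 2 * count_list xs v} \<subseteq> {xs. (4::real) ^ T \<le> 16 ^ count_list xs v}"
  proof safe
    fix xs assume "T \<le> 2 * count_list xs v"
    then have "(4::real) ^ T \<le> 4 ^ (2 * count_list xs v)" by (intro power_increasing) auto
    then show "(4::real) ^ T \<le> 16 ^ count_list xs v" by (simp add: power_mult)
  qed
  then have "measure_pmf.prob (replicate_pmf T p) {xs. T \<le> 2 * count_list xs v} \<le>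
      measure_pmf.prob (replicate_pmf T p) {xs. (4::real) ^ T \<le> 16 ^ count_list xs v}"
    by (intro measure_pmf.finite_measure_mono) auto
  also have "\<dots> \<le> expct (replicate_pmf T p) (\<lambda>xs. 16 ^ count_list xs v) / 4 ^ T"
    by (intro markov_pmf finite_set_replicate_pmf fin) auto
  also have "\<dots> \<le> 2 ^ T / 4 ^ T" by (rule E)
  also have "\<dots> = (1 / 2) ^ T" by (simp flip: power_divide)
  finally show ?thesis .
qed

section \<open>Composing algorithms\<close>

primrec bind_alg :: "'a alg \<Rightarrow> ('a \<Rightarrow> 'b alg) \<Rightarrow> 'b alg" where
  "bind_alg (Return r) f = f r"
| "bind_alg (Sample i k) f = Sample i (\<lambda>x. bind_alg (k x) f)"
| "bind_alg (Flip k) f = Flip (\<lambda>b. bind_alg (k b) f)"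

primrec replicate_alg :: "nat \<Rightarrow> 'a alg \<Rightarrow> 'a list alg" where
  "replicate_alg 0 a = Return []"
| "replicate_alg (Suc n) a = bind_alg a (\<lambda>x. bind_alg (replicate_alg n a) (\<lambda>xs. Return (x # xs)))"

lemma run_bind_alg: "run D (bind_alg a f) = bind_pmf (run D a) (\<lambda>r. run D (f r))"
  by (induction a) (auto simp: bind_return_pmf bind_assoc_pmf)

lemma run_replicate_alg: "run D (replicate_alg n a) = replicate_pmf n (run D a)"
  by (induction n) (auto simp: run_bind_alg)

lemma samples_le_mono: "samples_le a B \<Longrightarrow> B \<le> B' \<Longrightarrow> samples_le a B'"
proof (induction a arbitrary: B B')
  case (Sample i k)
  have "samples_le (k x) (B' - 1)" for x
    by (rule Sample.IH[OF rangeI, of x "B - 1"]) (use Sample.prems in simp_all)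
  then show ?case using Sample.prems by simp
next
  case (Flip k)
  have "samples_le (k x) B'" for x
    by (rule Flip.IH[OF rangeI, of x B]) (use Flip.prems in simp_all)
  then show ?case by simp
qed simp

lemma samples_le_bind_alg:
  assumes "samples_le a B" "\<And>r. samples_le (f r) B'" "0 \<le> B" "0 \<le> B'"
  shows "samples_le (bind_alg a f) (B + B')"
  using assms(1,3)
proof (induction a arbitrary: B)
  case (Return r)
  then show ?case using samples_le_mono[OF assms(2)] by simp
next
  case (Sample i k)
  have "samples_le (bind_alg (k x) f) ((B - 1) + B')" for x
    by (rule Sample.IH[OF rangeI]) (use Sample.prems in simp_all)
  then show ?case using Sample.prems assms(4) by (simp add: algebra_simps)
next
  case (Flip k)
  have "samples_le (bind_alg (k x) f) (B + B')" for x
    by (rule Flip.IH[OF rangeI]) (use Flip.prems in simp_all)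
  then show ?case by simp
qed

lemma samples_le_replicate_alg:
  assumes "samples_le a B" "0 \<le> B"
  shows "samples_le (replicate_alg n a) (real n * B)"
proof (induction n)
  case (Suc n)
  have "samples_le (bind_alg a (\<lambda>x. bind_alg (replicate_alg n a) (\<lambda>xs. Return (x # xs)))) (B + (real n * B + 0))"
    using Suc assms by (intro samples_le_bind_alg) auto
  then show ?case by (simp add: algebra_simps)
qed simp

text \<open>Union bound over two stages: either the first result leaves \<open>G\<close>, or the
  continuation from a good result fails. It serves both to fix a good first batch and to peel tests
  off the search.\<close>

lemma prob_bind_pmf_le:
  assumes "measure_pmf.prob p (- G) \<le> a" "0 \<le> b"
    and "\<And>x. x \<in> set_pmf p \<Longrightarrow> x \<in> G \<Longrightarrow> measure_pmf.prob (f x) S \<le> b"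
  shows "measure_pmf.prob (bind_pmf p f) S \<le> a + b"
proof -
  have "emeasure (bind_pmf p f) S = (\<integral>\<^sup>+x. emeasure (f x) S \<partial>p)" by simp
  also have "\<dots> \<le> (\<integral>\<^sup>+x. indicator (- G) x + ennreal b \<partial>p)"
  proof (rule nn_integral_mono_AE, unfold AE_measure_pmf_iff, rule ballI)
    fix x assume x: "x \<in> set_pmf p"
    show "emeasure (f x) S \<le> indicator (- G) x + ennreal b"
    proof (cases "x \<in> G")
      case True
      then show ?thesis using ennreal_leI[OF assms(3)[OF x True]] by (simp add: measure_pmf.emeasure_eq_measure)
    next
      case False
      have "emeasure (f x) S \<le> 1" by (rule measure_pmf.emeasure_le_1)
      also have "\<dots> \<le> 1 + ennreal b" by simp
      finally show ?thesis using False by simp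
    qed
  qed
  also have "\<dots> = emeasure p (- G) + ennreal b"
    by (subst nn_integral_add) auto
  also have "\<dots> = ennreal (measure_pmf.prob p (- G) + b)"
    using assms(2) by (simp add: measure_pmf.emeasure_eq_measure)
  finally have "measure_pmf.prob (bind_pmf p f) S \<le> measure_pmf.prob p (- G) + b"
    using assms(2) by (simp add: measure_pmf.emeasure_eq_measure flip: ennreal_plus)
  with assms(1) show ?thesis by simp
qed

section \<open>The algorithm\<close>

definition draw_pair :: "nat \<Rightarrow> nat \<Rightarrow> (nat \<times> nat) alg" where
  "draw_pair i j = Sample i (\<lambda>x. Sample j (\<lambda>y. Return (x, y)))"

text \<open>A vote \<open>True\<close> claims that the distributions differ. The threshold is midway
  between the mean 0 in the identical case and the least mean
  \<open>(M + 1) * M * \<delta>^2\<close> in the separated case.\<close>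

definition collision_vote :: "(nat \<Rightarrow> real) \<Rightarrow> real \<Rightarrow> nat \<Rightarrow> nat \<Rightarrow> bool alg" where
  "collision_vote w \<delta> M j = bind_alg (replicate_alg (Suc M) (draw_pair 1 j))
     (\<lambda>zs. Return (real (Suc M) * real M * \<delta>\<^sup>2 / 2 \<le> pair_sum (collision_kernel w) zs))"

definition differs_from_first :: "(nat \<Rightarrow> real) \<Rightarrow> real \<Rightarrow> nat \<Rightarrow> nat \<Rightarrow> nat \<Rightarrow> bool alg" where
  "differs_from_first w \<delta> M T j = bind_alg (replicate_alg T (collision_vote w \<delta> M j))
     (\<lambda>bs. Return (T < 2 * count_list bs True))"

primrec first_hit :: "('a \<Rightarrow> bool alg) \<Rightarrow> 'a list \<Rightarrow> 'a option alg" where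
  "first_hit t [] = Return None"
| "first_hit t (j # js) = bind_alg (t j) (\<lambda>b. if b then Return (Some j) else first_hit t js)"

definition find_one_unknown :: "nat \<Rightarrow> real \<Rightarrow> nat \<Rightarrow> nat \<Rightarrow> nat \<Rightarrow> nat option alg" where
  "find_one_unknown m \<delta> k M T = bind_alg (replicate_alg k (Sample 1 Return))
     (\<lambda>xs. first_hit (differs_from_first (\<lambda>x. 1 / (1 + real (count_list xs x))) \<delta> M T) [2..<Suc m])"

section \<open>Output of the search when the tests are reliable\<close>

lemma run_draw_pair: "run D (draw_pair i j) = pair_pmf (D i) (D j)"
  by (simp add: draw_pair_def pair_pmf_def)

text \<open>If all executed tests answer correctly, the search retraces the deterministic
  \<open>find R js\<close>. Peeling off the first test gives a union bound over the list.\<close>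

lemma run_first_hit:
  assumes "\<And>j. j \<in> set js \<Longrightarrow> measure_pmf.prob (run D (t j)) {\<not> R j} \<le> \<eta>" "0 \<le> \<eta>"
  shows "measure_pmf.prob (run D (first_hit t js)) (- {find R js}) \<le> real (length js) * \<eta>"
  using assms(1)
proof (induction js)
  case Nil
  then show ?case by simp
next
  case (Cons j js)
  have compl: "- {R j} = {\<not> R j}" by auto
  have "measure_pmf.prob (run D (first_hit t (j # js))) (- {find R (j # js)}) \<le>
      \<eta> + real (length js) * \<eta>"
    unfolding first_hit.simps run_bind_alg
  proof (rule prob_bind_pmf_le[where G = "{R j}"])
    show "measure_pmf.prob (run D (t j)) (- {R j}) \<le> \<eta>" unfolding compl using Cons.prems by simp
    show "0 \<le> real (length js) * \<eta>" using assms(2) by simp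
    fix b assume "b \<in> {R j}"
    then show "measure_pmf.prob (run D (if b then Return (Some j) else first_hit t js)) (- {find R (j # js)})
        \<le> real (length js) * \<eta>"
      using Cons assms(2) by (cases "R j") auto
  qed
  then show ?case by (simp add: algebra_simps)
qed

section \<open>Worst-case sample counts\<close>

lemma samples_le_first_hit:
  assumes "\<And>j. samples_le (t j) B" "0 \<le> B"
  shows "samples_le (first_hit t js) (real (length js) * B)"
proof (induction js)
  case (Cons j js)
  have "samples_le (first_hit t (j # js)) (B + real (length js) * B)"
    unfolding first_hit.simps using Cons assms by (intro samples_le_bind_alg) auto
  then show ?case by (simp add: algebra_simps)
qed simp

lemma samples_le_differs_from_first:
  "samples_le (differs_from_first w \<delta> M T j) (real T * (real (Suc M) * 2))"
proof -
  have "samples_le (draw_pair 1 j) 2" by (simp add: draw_pair_def)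
  then have "samples_le (replicate_alg (Suc M) (draw_pair 1 j)) (real (Suc M) * 2)"
    by (intro samples_le_replicate_alg) auto
  then have "samples_le (collision_vote w \<delta> M j) (real (Suc M) * 2 + 0)"
    unfolding collision_vote_def by (rule samples_le_bind_alg) auto
  then have "samples_le (replicate_alg T (collision_vote w \<delta> M j)) (real T * (real (Suc M) * 2))"
    by (intro samples_le_replicate_alg) auto
  then have "samples_le (differs_from_first w \<delta> M T j) (real T * (real (Suc M) * 2) + 0)"
    unfolding differs_from_first_def by (rule samples_le_bind_alg) auto
  then show ?thesis by simp
qed

lemma samples_le_find_one_unknown:
  "samples_le (find_one_unknown m \<delta> k M T) (real k + real (m - 1) * (real T * (real (Suc M) * 2)))"
proof -
  have 1: "samples_le (replicate_alg k (Sample 1 Return)) (real k * 1)"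
    by (rule samples_le_replicate_alg) auto
  have 2: "samples_le (first_hit (differs_from_first w \<delta> M T) [2..<Suc m])
      (real (m - 1) * (real T * (real (Suc M) * 2)))" for w
    using samples_le_first_hit[where t = "differs_from_first w \<delta> M T" and js = "[2..<Suc m]",
        OF samples_le_differs_from_first]
    by (simp del: upt_Suc)
  show ?thesis unfolding find_one_unknown_def
    using samples_le_bind_alg[OF 1 2] by simp
qed

section \<open>Error probability of one amplified test\<close>

lemma prob_differs_from_first:
  fixes D :: "nat \<Rightarrow> nat pmf" and w :: "nat \<Rightarrow> real" and A :: "nat set" and b \<delta> :: real and j :: nat
  defines "\<theta> \<equiv> \<Sum>a\<in>A. w a * (pmf (D 1) a - pmf (D j) a)\<^sup>2"
  assumes "finite A" "set_pmf (D 1) \<subseteq> A" "set_pmf (D j) \<subseteq> A" "\<And>x. 0 \<le> w x" "\<And>x. w x \<le> 1"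
    and "(\<Sum>a\<in>A. w a * (pmf (D 1) a)\<^sup>2) \<le> b\<^sup>2" "0 < \<delta>" "\<delta> \<le> b"
    and "10240 * b / \<delta>\<^sup>2 \<le> real M" "\<theta> = 0 \<or> \<delta>\<^sup>2 \<le> \<theta>"
  shows "measure_pmf.prob (run D (differs_from_first w \<delta> M T j)) {\<theta> = 0} \<le> (1 / 2) ^ T"
proof -
  \<comment> \<open>Since \<open>True\<close> means that the distributions differ, the Boolean
    \<open>\<theta> = 0\<close> is precisely the wrong answer, both for a single vote and for the
    majority.\<close>
  let ?v = "\<theta> = 0" and ?p = "run D (collision_vote w \<delta> M j)"
  let ?U = "\<lambda>zs. real (Suc M) * real M * \<delta>\<^sup>2 / 2 \<le> pair_sum (collision_kernel w) zs"
  have vote: "?p = map_pmf ?U (replicate_pmf (Suc M) (pair_pmf (D 1) (D j)))"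
    unfolding collision_vote_def run_bind_alg run_replicate_alg run_draw_pair
    by (simp add: map_pmf_def del: replicate_pmf.simps)
  have "pmf ?p ?v = measure_pmf.prob (replicate_pmf (Suc M) (pair_pmf (D 1) (D j))) {zs. ?U zs = ?v}"
    unfolding vote pmf_map by (rule arg_cong[where f = "measure_pmf.prob _"]) auto
  also have "\<dots> \<le> 1 / 16"
    unfolding \<theta>_def using assms(2-) by (intro collision_test[where b = b]) (auto simp: \<theta>_def)
  finally have v: "pmf ?p ?v \<le> 1 / 16" .
  have count: "count_list bs True + count_list bs False = length bs" for bs
    by (induction bs) auto
  have "run D (differs_from_first w \<delta> M T j) = map_pmf (\<lambda>bs. T < 2 * count_list bs True) (replicate_pmf T ?p)"
    unfolding differs_from_first_def run_bind_alg run_replicate_alg by (simp add: map_pmf_def)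
  then have "measure_pmf.prob (run D (differs_from_first w \<delta> M T j)) {?v} =
      measure_pmf.prob (replicate_pmf T ?p) ((\<lambda>bs. T < 2 * count_list bs True) -` {?v})"
    by simp
  \<comment> \<open>A tie is reported as \<open>False\<close>; counting ties as failures covers both
    possible wrong answers. For \<open>False\<close> the two counts adding up to \<open>T\<close>
    give the inequality.\<close>
  also have "\<dots> \<le> measure_pmf.prob (replicate_pmf T ?p) {bs. T \<le> 2 * count_list bs ?v}"
  proof (rule measure_pmf.finite_measure_mono_AE)
    show "AE bs in replicate_pmf T ?p. bs \<in> (\<lambda>bs. T < 2 * count_list bs True) -` {?v} \<longrightarrow>
        bs \<in> {bs. T \<le> 2 * count_list bs ?v}"
      unfolding AE_measure_pmf_iff
    proof (intro ballI impI)
      fix bs assume bs: "bs \<in> set_pmf (replicate_pmf T ?p)" "bs \<in> (\<lambda>bs. T < 2 * count_list bs True) -` {?v}"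
      then have "length bs = T" by (simp add: set_replicate_pmf)
      then show "bs \<in> {bs. T \<le> 2 * count_list bs ?v}"
        using bs(2) count[of bs] by (cases ?v) auto
    qed
  qed simp
  also have "\<dots> \<le> (1 / 2) ^ T" using v by (intro majority_vote) auto
  finally show ?thesis .
qed

section \<open>Total variation distance and the weighted norm\<close>

text \<open>Triangle inequality on each event; the exact factor 1/2 is given up, which only affects
  constants.\<close>

lemma dTV_le_sum:
  assumes "finite A" "set_pmf P \<subseteq> A" "set_pmf Q \<subseteq> A"
  shows "dTV P Q \<le> (\<Sum>a\<in>A. \<bar>pmf P a - pmf Q a\<bar>)"
  unfolding dTV_def
proof (rule cSUP_least)
  fix S
  have eq: "measure_pmf.prob p S = (\<Sum>a\<in>A. pmf p a * indicator S a)" if "set_pmf p \<subseteq> A" for p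
    using expct_eq_sum[OF assms(1) that, of "indicator S"] by simp
  have "\<bar>measure_pmf.prob P S - measure_pmf.prob Q S\<bar> = \<bar>\<Sum>a\<in>A. (pmf P a - pmf Q a) * indicator S a\<bar>"
    using assms by (simp add: eq sum_subtractf left_diff_distrib)
  also have "\<dots> \<le> (\<Sum>a\<in>A. \<bar>(pmf P a - pmf Q a) * indicator S a\<bar>)" by (rule sum_abs)
  also have "\<dots> \<le> (\<Sum>a\<in>A. \<bar>pmf P a - pmf Q a\<bar>)"
    by (intro sum_mono) (auto simp: indicator_def)
  finally show "\<bar>measure_pmf.prob P S - measure_pmf.prob Q S\<bar> \<le> (\<Sum>a\<in>A. \<bar>pmf P a - pmf Q a\<bar>)" .
qed simp

lemma sum_count_list_le: "finite A \<Longrightarrow> (\<Sum>a\<in>A. count_list xs a) \<le> length xs"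
proof (induction xs)
  case (Cons x xs)
  have "(\<Sum>a\<in>A. count_list (x # xs) a) = (\<Sum>a\<in>A. count_list xs a) + (\<Sum>a\<in>A. if x = a then 1 else 0)"
    unfolding sum.distrib[symmetric] by (intro sum.cong) auto
  then show ?case using Cons by simp
qed simp

text \<open>Cauchy-Schwarz after writing each difference as (difference / sqrt c) * sqrt c with
  \<open>c = 1 + count\<close>: the second factor sums to the number of points plus at most the
  number of draws.\<close>

lemma weighted_norm_ge_dTV:
  assumes A: "finite A" "set_pmf P \<subseteq> A" "set_pmf Q \<subseteq> A" and \<epsilon>: "0 \<le> \<epsilon>" "\<epsilon> \<le> dTV P Q"
  shows "\<epsilon>\<^sup>2 \<le> (\<Sum>a\<in>A. 1 / (1 + real (count_list xs a)) * (pmf P a - pmf Q a)\<^sup>2) *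
    (real (card A) + real (length xs))"
proof -
  let ?c = "\<lambda>a. 1 + real (count_list xs a)" and ?\<mu> = "\<lambda>a. pmf P a - pmf Q a"
  have "\<epsilon>\<^sup>2 \<le> (\<Sum>a\<in>A. \<bar>?\<mu> a\<bar>)\<^sup>2"
    using dTV_le_sum[OF A] \<epsilon> by (intro power_mono) auto
  also have "(\<Sum>a\<in>A. \<bar>?\<mu> a\<bar>) = (\<Sum>a\<in>A. (\<bar>?\<mu> a\<bar> / sqrt (?c a)) * sqrt (?c a))"
    by (intro sum.cong) (auto simp: add_nonneg_eq_0_iff)
  also have "\<dots>\<^sup>2 \<le> (\<Sum>a\<in>A. (\<bar>?\<mu> a\<bar> / sqrt (?c a))\<^sup>2) * (\<Sum>a\<in>A. (sqrt (?c a))\<^sup>2)"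
    by (rule Cauchy_Schwarz_ineq_sum)
  also have "\<dots> = (\<Sum>a\<in>A. 1 / ?c a * (?\<mu> a)\<^sup>2) * (real (card A) + real (\<Sum>a\<in>A. count_list xs a))"
    by (simp add: power_divide sum.distrib)
  also have "\<dots> \<le> (\<Sum>a\<in>A. 1 / ?c a * (?\<mu> a)\<^sup>2) * (real (card A) + real (length xs))"
    using sum_count_list_le[OF A(1), of xs]
    by (intro mult_left_mono add_left_mono sum_nonneg) (simp_all only: of_nat_le_iff, simp)
  finally show ?thesis .
qed

section \<open>Success probability of the algorithm\<close>

lemma prob_find_one_unknown:
  fixes P Q :: "nat pmf" and D :: "nat \<Rightarrow> nat pmf" and \<epsilon> :: real
  assumes P: "set_pmf P \<subseteq> {1..n}" and Q: "set_pmf Q \<subseteq> {1..n}"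
    and \<epsilon>: "0 < \<epsilon>" "\<epsilon> < 1" "\<epsilon> \<le> dTV P Q"
    and D1: "D 1 = P" and D: "\<And>j. j \<in> {2..m} \<Longrightarrow> D j = P \<or> D j = Q"
    and k: "1 \<le> k" "k \<le> n" and M: "81920 * (real n / (sqrt k * \<epsilon>\<^sup>2)) \<le> real M"
    and T: "10 * real m \<le> 2 ^ T"
  shows "8 / 10 \<le> measure_pmf.prob (run D (find_one_unknown m (\<epsilon> / sqrt (2 * real n)) k M T))
    {find (\<lambda>j. D j \<noteq> D 1) [2..<Suc m]}"
proof -
  \<comment> \<open>Since \<open>k \<le> n\<close>, the guaranteed gap
    \<open>\<epsilon>^2 / (n + k)\<close> is at least \<open>\<epsilon>^2 / (2 n)\<close>, which is
    taken as \<open>\<delta>^2\<close>. Likewise \<open>b^2 = 10 / k\<close> is the norm reached by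
    flattening.\<close>
  define \<delta> where "\<delta> = \<epsilon> / sqrt (2 * real n)"
  define b where "b = sqrt (10 / real k)"
  let ?w = "\<lambda>xs x. 1 / (1 + real (count_list xs x))"
  let ?R = "\<lambda>j. D j \<noteq> D 1"
  have n: "0 < real n" using k by simp
  have \<delta>2: "\<delta>\<^sup>2 = \<epsilon>\<^sup>2 / (2 * real n)" and \<delta>0: "0 < \<delta>"
    using n \<epsilon> by (simp_all add: \<delta>_def power_divide)
  have \<delta>b: "\<delta> \<le> b"
  proof -
    have "\<epsilon>\<^sup>2 \<le> 1" using \<epsilon> by (simp add: power_le_one)
    then have "\<delta>\<^sup>2 \<le> 1 / (2 * real n)" unfolding \<delta>2 by (intro divide_right_mono) auto
    also have "\<dots> \<le> 10 / real k" using k n by (intro frac_le) auto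
    finally show ?thesis unfolding b_def by (rule real_le_rsqrt)
  qed
  \<comment> \<open>The constant is 81920 = 10240 * 4 * 2, with 4 bounding \<open>sqrt 10\<close>
    and 2 coming from \<open>1 / \<delta>^2 = 2 n / \<epsilon>^2\<close>.\<close>
  have Mb: "10240 * b / \<delta>\<^sup>2 \<le> real M"
  proof -
    have "sqrt 10 \<le> 4" by (rule real_le_lsqrt) auto
    then have "b \<le> 4 / sqrt k" unfolding b_def real_sqrt_divide by (intro divide_right_mono) auto
    then have "10240 * b / \<delta>\<^sup>2 \<le> 10240 * (4 / sqrt k) / \<delta>\<^sup>2"
      by (intro divide_right_mono mult_left_mono) auto
    also have "\<dots> = 81920 * (real n / (sqrt k * \<epsilon>\<^sup>2))" unfolding \<delta>2 by simp
    finally show ?thesis using M by simp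
  qed
  \<comment> \<open>The batch \<open>xs\<close> is held fixed here, so the weights are deterministic
    and every test uses fresh samples.\<close>
  have search: "measure_pmf.prob (run D (first_hit (differs_from_first (?w xs) \<delta> M T) [2..<Suc m]))
      (- {find ?R [2..<Suc m]}) \<le> 1 / 10"
    if len: "length xs = k" and norm: "(\<Sum>a\<in>{1..n}. ?w xs a * (pmf P a)\<^sup>2) < 10 / (1 + real k)" for xs
  proof -
    have "measure_pmf.prob (run D (first_hit (differs_from_first (?w xs) \<delta> M T) [2..<Suc m]))
        (- {find ?R [2..<Suc m]}) \<le> real (length [2..<Suc m]) * (1 / 2) ^ T"
    proof (rule run_first_hit)
      fix j assume "j \<in> set [2..<Suc m]"
      then have j: "D j = P \<or> D j = Q" using D[of j] by auto
      define \<theta> where "\<theta> = (\<Sum>a\<in>{1..n}. ?w xs a * (pmf (D 1) a - pmf (D j) a)\<^sup>2)"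
      have gap: "\<delta>\<^sup>2 \<le> \<theta>" if "D j = Q"
      proof -
        have "\<epsilon>\<^sup>2 \<le> \<theta> * (real n + real k)"
          using weighted_norm_ge_dTV[OF _ P Q, of \<epsilon> xs] \<epsilon> len that unfolding \<theta>_def D1 by simp
        also have "\<dots> \<le> \<theta> * (2 * real n)"
          using k unfolding \<theta>_def by (intro mult_left_mono sum_nonneg) auto
        finally show ?thesis using n unfolding \<delta>2 by (simp add: divide_le_eq)
      qed
      have zero: "\<theta> = 0" if "D j = P" using that D1 unfolding \<theta>_def by simp
      have iff: "(\<not> ?R j) = (\<theta> = 0)"
      proof (cases "D j = P")
        case False
        then have "\<delta>\<^sup>2 \<le> \<theta>" using j gap by blast
        moreover have "0 < \<delta>\<^sup>2" using \<delta>0 by simp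
        ultimately show ?thesis using False D1 by auto
      qed (use zero D1 in simp)
      have "(\<Sum>a\<in>{1..n}. ?w xs a * (pmf (D 1) a)\<^sup>2) \<le> b\<^sup>2"
      proof -
        have "10 / (1 + real k) \<le> 10 / real k" using k by (intro frac_le) auto
        then show ?thesis using norm unfolding D1 b_def by simp
      qed
      then show "measure_pmf.prob (run D (differs_from_first (?w xs) \<delta> M T j)) {\<not> ?R j} \<le> (1 / 2) ^ T"
        unfolding iff \<theta>_def using P Q D1 j gap zero \<delta>0 \<delta>b Mb
        by (intro prob_differs_from_first[where b = b]) (auto simp: \<theta>_def)
    qed simp
    also have "\<dots> \<le> real m * (1 / 2) ^ T" by (intro mult_right_mono) auto
    also have "\<dots> \<le> 1 / 10" using T by (simp add: power_one_over field_simps)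
    finally show ?thesis .
  qed
  let ?G = "{xs. length xs = k \<and> (\<Sum>a\<in>{1..n}. ?w xs a * (pmf P a)\<^sup>2) < 10 / (1 + real k)}"
  \<comment> \<open>One tenth is spent on a batch that fails to flatten P, another on some test
    being wrong.\<close>
  have "measure_pmf.prob (run D (find_one_unknown m \<delta> k M T)) (- {find ?R [2..<Suc m]}) \<le> 1 / 10 + 1 / 10"
    unfolding find_one_unknown_def run_bind_alg run_replicate_alg
  proof (rule prob_bind_pmf_le)
    have run1: "run D (Sample 1 Return) = P" by (simp add: D1[simplified] bind_return_pmf')
    have "measure_pmf.prob (replicate_pmf k P) (- ?G) \<le> measure_pmf.prob (replicate_pmf k P)
        {xs. 10 / (1 + real k) \<le> (\<Sum>a\<in>{1..n}. ?w xs a * (pmf P a)\<^sup>2)}"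
      by (rule measure_pmf.finite_measure_mono_AE) (auto simp: AE_measure_pmf_iff set_replicate_pmf)
    also have "\<dots> \<le> 1 / 10" by (rule flattened_norm) (use P in auto)
    finally show "measure_pmf.prob (replicate_pmf k (run D (Sample 1 Return))) (- ?G) \<le> 1 / 10"
      unfolding run1 .
  qed (use search in auto)
  then show ?thesis unfolding \<delta>_def
    by (subst (asm) measure_pmf.prob_compl[unfolded space_measure_pmf Compl_eq_Diff_UNIV[symmetric]]) auto
qed

section \<open>Choice of parameters and the resulting cost\<close>

lemma sample_bound:
  fixes \<epsilon> :: real
  assumes n: "1 \<le> n" and m: "2 \<le> m" and \<epsilon>: "0 < \<epsilon>" "\<epsilon> < 1"
  defines "y \<equiv> (real n * real m / \<epsilon>\<^sup>2) powr (2/3)"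
  defines "k \<equiv> min n (nat \<lceil>y\<rceil>)"
  defines "z \<equiv> real n / (sqrt k * \<epsilon>\<^sup>2)"
  defines "M \<equiv> nat \<lceil>81920 * z\<rceil>" and "T \<equiv> nat \<lceil>8 * ln (real m)\<rceil>"
  shows "1 \<le> k" "10 * real m \<le> 2 ^ T"
    "real k + real (m - 1) * (real T * (real (Suc M) * 2)) \<le>
       2000000 * max y (real m * sqrt n / \<epsilon>\<^sup>2) * ln m"
proof -
  define x where "x = real n * real m / \<epsilon>\<^sup>2"
  define L where "L = max y (real m * sqrt n / \<epsilon>\<^sup>2)"
  have y: "y = x powr (2/3)" by (simp add: y_def x_def)
  have \<epsilon>2: "0 < \<epsilon>\<^sup>2" "\<epsilon>\<^sup>2 \<le> 1" using \<epsilon> by (auto simp: power_le_one)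
  have "1 * 1 \<le> real n * real m" using n m by (intro mult_mono) auto
  then have x1: "1 \<le> x" unfolding x_def using \<epsilon>2 by (simp add: le_divide_eq)
  then have y1: "1 \<le> y" unfolding y by (simp add: ge_one_powr_ge_zero)
  then have ceil_y: "y \<le> real (nat \<lceil>y\<rceil>)" "real (nat \<lceil>y\<rceil>) \<le> y + 1" by linarith+
  have "1 \<le> nat \<lceil>y\<rceil>" using y1 by linarith
  then show k1: "1 \<le> k" using n by (simp add: k_def)
  have "real k \<le> real (nat \<lceil>y\<rceil>)" unfolding k_def by (intro of_nat_mono) simp
  then have ky: "real k \<le> 2 * y" using ceil_y y1 by linarith
  have kn: "real k \<le> real n" by (simp add: k_def)
  have z1: "1 \<le> z"
  proof -
    have "sqrt k * \<epsilon>\<^sup>2 \<le> sqrt k * sqrt k"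
      using k1 \<epsilon>2 by (intro mult_left_mono order_trans[OF \<epsilon>2(2)]) auto
    also have "\<dots> \<le> real n" using kn by simp
    finally show ?thesis unfolding z_def using k1 \<epsilon>2 by (simp add: le_divide_eq)
  qed
  \<comment> \<open>The two terms of the maximum match the two cases of the minimum:
    \<open>k = n\<close> gives \<open>m sqrt n / \<epsilon>^2\<close>, and otherwise
    \<open>k \<ge> x powr (2/3)\<close> gives \<open>x / sqrt k \<le> x powr (2/3)\<close>.\<close>
  have mz: "real m * z \<le> L"
  proof (cases "k = n")
    case True
    have cancel: "a * (s * s) / (s * e) = a * s / e" if "s \<noteq> 0" for a s e :: real
      using that by simp
    have "real m * z = real m * (sqrt n * sqrt n) / (sqrt n * \<epsilon>\<^sup>2)" using True by (simp add: z_def)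
    also have "\<dots> = real m * sqrt n / \<epsilon>\<^sup>2" by (rule cancel) (use n in simp)
    finally show ?thesis by (simp add: L_def)
  next
    case False
    then have "y \<le> real k" using ceil_y unfolding k_def by (auto simp: min_def split: if_splits)
    have "x powr (1/3) = sqrt y"
      unfolding y using x1 by (simp add: powr_powr flip: powr_half_sqrt)
    also have "\<dots> \<le> sqrt k" using \<open>y \<le> real k\<close> by simp
    finally have *: "x powr (1/3) \<le> sqrt k" .
    have "real m * z = x / sqrt k" by (simp add: z_def x_def mult_ac)
    also have "\<dots> \<le> x / x powr (1/3)" using * x1 k1 by (intro divide_left_mono mult_pos_pos) auto
    also have "\<dots> = y" unfolding y using x1 powr_diff[of x 1 "1/3"] by simp
    finally show ?thesis by (simp add: L_def)
  qed
  have "2 / 3 \<le> ln (2::real)" by (rule ln2_ge_two_thirds)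
  also have ln2m: "ln 2 \<le> ln (real m)" using m by simp
  finally have lnm: "2 / 3 \<le> ln (real m)" .
  have T: "8 * ln (real m) \<le> real T" "real T \<le> 8 * ln (real m) + 1"
    unfolding T_def using lnm by linarith+
  \<comment> \<open>Because \<open>m \<ge> 2\<close>, \<open>10 m\<close> is at most
    \<open>m^5\<close>, and 5 is at most 8 * 2/3 with 2/3 a lower bound for
    \<open>ln 2\<close>.\<close>
  show "10 * real m \<le> 2 ^ T"
  proof -
    have "10 * real m \<le> 2 ^ 4 * real m" by simp
    also have "\<dots> \<le> real m ^ 4 * real m" using m by (intro mult_right_mono power_mono) auto
    also have "\<dots> = real m ^ 5" by (simp add: power_numeral_reduce)
    also have "\<dots> = exp (5 * ln (real m))" using m by (simp add: exp_of_nat_mult[of 5, simplified])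
    also have "\<dots> \<le> exp (real T * ln 2)"
    proof -
      have "5 * ln (real m) \<le> (8 * ln (real m)) * (2 / 3)" using lnm by simp
      also have "\<dots> \<le> real T * ln 2" using T lnm ln2_ge_two_thirds by (intro mult_mono) auto
      finally show ?thesis by simp
    qed
    also have "\<dots> = 2 ^ T" by (simp add: exp_of_nat_mult)
    finally show ?thesis .
  qed
  \<comment> \<open>The summand 2 pays for the ceiling and for the successor, and is absorbed using
    \<open>z \<ge> 1\<close>.\<close>
  have "real (Suc M) \<le> 81920 * z + 2" unfolding M_def using z1 by simp linarith
  then have M: "real (Suc M) \<le> 81922 * z" using z1 by linarith
  have L0: "0 \<le> L" using y1 by (simp add: L_def)
  \<comment> \<open>As \<open>1 \<le> 2 ln m\<close>, the rounding in \<open>T\<close> fits into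
    \<open>10 ln m\<close>; then 10 * 81922 * 2 = 1638440, and the first batch adds only 4, well
    below 2000000.\<close>
  have "real (m - 1) * (real T * (real (Suc M) * 2)) \<le> real m * ((10 * ln (real m)) * ((81922 * z) * 2))"
    using T lnm M z1 by (intro mult_mono) auto
  also have "\<dots> = 1638440 * (real m * z) * ln (real m)" by simp
  also have "\<dots> \<le> 1638440 * L * ln (real m)"
    using mz lnm by (intro mult_right_mono mult_left_mono) auto
  finally have 1: "real (m - 1) * (real T * (real (Suc M) * 2)) \<le> 1638440 * L * ln (real m)" .
  have "real k \<le> 2 * L * 1" using ky by (simp add: L_def)
  also have "\<dots> \<le> 2 * L * (2 * ln (real m))" using L0 lnm by (intro mult_left_mono) auto
  finally have 2: "real k \<le> 4 * (L * ln (real m))" by simp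
  have "0 \<le> L * ln (real m)" using L0 lnm by simp
  then show "real k + real (m - 1) * (real T * (real (Suc M) * 2)) \<le>
       2000000 * max y (real m * sqrt n / \<epsilon>\<^sup>2) * ln m"
    using 1 2 unfolding L_def[symmetric] by (simp only: mult.assoc)
qed

theorem theoremC2:
  "\<exists>(C::real) > 0. \<exists>A :: nat \<Rightarrow> nat \<Rightarrow> real \<Rightarrow> nat option alg.
     \<forall>n m \<epsilon>. 27 \<le> n \<and> 2 \<le> m \<and> 0 < \<epsilon> \<and> \<epsilon> < 1 \<longrightarrow>
       samples_le (A n m \<epsilon>)
         (C * max ((real n * real m / \<epsilon>\<^sup>2) powr (2/3)) (real m * sqrt (real n) / \<epsilon>\<^sup>2) * ln (real m))
       \<and> (\<forall>(P::nat pmf) (Q::nat pmf) (Chi::nat set) (D::nat \<Rightarrow> nat pmf).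
            set_pmf P \<subseteq> {1..n} \<and> set_pmf Q \<subseteq> {1..n} \<and> dTV P Q \<ge> \<epsilon> \<and>
            Chi \<subseteq> {1..m} \<and> 1 \<in> Chi \<and>
            (\<forall>i\<in>{1..m}. D i = (if i \<in> Chi then P else Q)) \<longrightarrow>
            (Chi = {1..m} \<longrightarrow>
               measure_pmf.prob (run D (A n m \<epsilon>)) {None} \<ge> 2/3) \<and>
            (Chi \<noteq> {1..m} \<longrightarrow>
               measure_pmf.prob (run D (A n m \<epsilon>))
                 {Some j | j. j \<in> {1..m} \<and> j \<noteq> 1 \<and> D j \<noteq> D 1} \<ge> 2/3))"
proof -
  define k where "k = (\<lambda>n m \<epsilon>::real. min n (nat \<lceil>(real n * real m / \<epsilon>\<^sup>2) powr (2/3)\<rceil>))"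
  define M where "M = (\<lambda>n m \<epsilon>. nat \<lceil>81920 * (real n / (sqrt (k n m \<epsilon>) * \<epsilon>\<^sup>2))\<rceil>)"
  define T where "T = (\<lambda>m. nat \<lceil>8 * ln (real m)\<rceil>)"
  define A where "A = (\<lambda>n m \<epsilon>. find_one_unknown m (\<epsilon> / sqrt (2 * real n)) (k n m \<epsilon>) (M n m \<epsilon>) (T m))"
  show ?thesis
  proof (intro exI[of _ 2000000] conjI exI[of _ A] allI impI, simp)
    fix n m :: nat and \<epsilon> assume "27 \<le> n \<and> 2 \<le> m \<and> 0 < \<epsilon> \<and> \<epsilon> < (1::real)"
    then have n: "1 \<le> n" and m: "2 \<le> m" and \<epsilon>: "0 < \<epsilon>" "\<epsilon> < 1" by auto
    have bounds: "1 \<le> k n m \<epsilon>" "10 * real m \<le> 2 ^ T m"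
      "real (k n m \<epsilon>) + real (m - 1) * (real (T m) * (real (Suc (M n m \<epsilon>)) * 2)) \<le>
        2000000 * max ((real n * real m / \<epsilon>\<^sup>2) powr (2/3)) (real m * sqrt n / \<epsilon>\<^sup>2) * ln m"
      unfolding M_def k_def T_def by (rule sample_bound[OF n m \<epsilon>])+
    show "samples_le (A n m \<epsilon>)
        (2000000 * max ((real n * real m / \<epsilon>\<^sup>2) powr (2/3)) (real m * sqrt (real n) / \<epsilon>\<^sup>2) * ln (real m))"
      unfolding A_def by (rule samples_le_mono[OF samples_le_find_one_unknown bounds(3)])
    fix P Q :: "nat pmf" and Chi and D :: "nat \<Rightarrow> nat pmf"
    assume asm: "set_pmf P \<subseteq> {1..n} \<and> set_pmf Q \<subseteq> {1..n} \<and> dTV P Q \<ge> \<epsilon> \<and>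
      Chi \<subseteq> {1..m} \<and> 1 \<in> Chi \<and> (\<forall>i\<in>{1..m}. D i = (if i \<in> Chi then P else Q))"
    then have D: "D i = (if i \<in> Chi then P else Q)" if "i \<in> {1..m}" for i using that by blast
    have D1: "D 1 = P" using D[of 1] asm m by simp
    \<comment> \<open>This is the deterministic correct answer, \<open>None\<close> or the least
      differing index. Its singleton lies in the set of accepted outputs in both cases, so
      \<open>8/10\<close> suffices for \<open>2/3\<close>.\<close>
    let ?found = "find (\<lambda>j. D j \<noteq> D 1) [2..<Suc m]"
    have "81920 * (real n / (sqrt (k n m \<epsilon>) * \<epsilon>\<^sup>2)) \<le> real (M n m \<epsilon>)"
      unfolding M_def by linarith
    then have prob: "8 / 10 \<le> measure_pmf.prob (run D (A n m \<epsilon>)) {?found}"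
      unfolding A_def using asm \<epsilon> D D1 bounds(1,2)
      by (intro prob_find_one_unknown[of P n Q]) (auto simp: k_def)
    {
      assume "Chi = {1..m}"
      then have "?found = None" using D D1 by (auto simp: find_None_iff simp del: upt_Suc)
      then show "2/3 \<le> measure_pmf.prob (run D (A n m \<epsilon>)) {None}" using prob by simp
    next
      assume "Chi \<noteq> {1..m}"
      then obtain i where i: "i \<in> {1..m}" "i \<notin> Chi" using asm by blast
      \<comment> \<open>Equal distributions would have total variation distance 0, below
        \<epsilon>.\<close>
      have "P \<noteq> Q" using asm \<epsilon> by (auto simp: dTV_def)
      then have "D i \<noteq> D 1" using D[of i] i D1 by simp
      moreover have "i \<noteq> 1" using i asm by auto
      then have "i \<in> set [2..<Suc m]" using i by auto
      ultimately have "?found \<noteq> None" unfolding find_None_iff by blast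
      then obtain j where "?found = Some j" by auto
      moreover from this have "j \<in> {1..m} \<and> j \<noteq> 1 \<and> D j \<noteq> D 1"
        by (auto simp: find_Some_iff simp del: upt_Suc)
      ultimately have "measure_pmf.prob (run D (A n m \<epsilon>)) {?found} \<le> measure_pmf.prob (run D (A n m \<epsilon>))
          {Some j | j. j \<in> {1..m} \<and> j \<noteq> 1 \<and> D j \<noteq> D 1}"
        by (intro measure_pmf.finite_measure_mono) auto
      then show "2/3 \<le> measure_pmf.prob (run D (A n m \<epsilon>))
          {Some j | j. j \<in> {1..m} \<and> j \<noteq> 1 \<and> D j \<noteq> D 1}"
        using prob by simp
    }
  qed
qed

end
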